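(* Let $f:\mathbb{R}^n\to\mathbb{R}$ be quasidifferentiable at $x\in\mathbb{R}^n$ with $$f'(x;l)=\delta^*(l,\underline{\partial}f(x))-\delta^*(l,\ominus\overline{\partial}f(x))\qquad(l\in S_{n-1})$$ and $\underline{\partial}f(x),\overline{\partial}f(x)\in\mathcal{C}(\mathbb{R}^n)$. For $n\ge2$ and $l\in S_{n-1}$ let $f_l:\mathbb{R}^{n-1}\to\mathbb{R}$, $f_l(y):=f'(x;\,l+\Pi_{n-1,l}^{\top}y)$. Then $$\overrightarrow{\partial}_{QD} f(x)=\begin{cases}\left(f'(x;l)\right)_{l=\pm1} & \text{for } n=1,\\[2pt] \left(\overrightarrow{\partial}_{QD} f_l(0),\,f'(x;l)\right)_{l\in S_{n-1}} & \text{for } n\ge 2.\end{cases}$$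
   Context: Notation. $S_{n-1}$ is the Euclidean unit sphere of $\mathbb{R}^n$; $\mathcal{C}(\mathbb{R}^n)$ is the family of nonempty convex compact subsets of $\mathbb{R}^n$. For $C\in\mathcal{C}(\mathbb{R}^n)$ and $l\in\mathbb{R}^n$, $\delta^*(l,C):=\max_{c\in C}\langle l,c\rangle$, $Y(l,C):=\{y\in C:\langle l,y\rangle=\delta^*(l,C)\}$, and $\ominus C:=\{-c: c\in C\}$. The (Dini) directional derivative is $f'(x;l):=\lim_{t\downarrow0}\frac{f(x+tl)-f(x)}{t}$. Rotations and projections. For every $n\ge2$ and $l\in S_{n-1}$ a rotation matrix $R_{n,l}$ of $\mathbb{R}^n$ is fixed once and for all with $R_{n,l}(l)=e^n$ and $R_{n,l}(\mathrm{span}\{l\}^\perp)=\mathrm{span}\{e^1,\dots,e^{n-1}\}$. Let $\pi_{n-1,n}\in\mathbb{R}^{(n-1)\times n}$, $\pi_{n-1,n}(x_1,\dots,x_n)=(x_1,\dots,x_{n-1})$, and $\Pi_{n-1,l}:=\pi_{n-1,n}R_{n,l}$. Its transpose $\Pi_{n-1,l}^{\top}=R_{n,l}^{-1}\pi_{n-1,n}^{\top}$ maps $\mathbb{R}^{n-1}$ onto $\mathrm{span}\{l\}^\perp$. Directed sets (recursive definition). A directed set in $\mathbb{R}$ is a pair $\overrightarrow{A}=(a_1(-1),a_1(1))=(a_1(l))_{l=\pm1}\in\mathbb{R}^2$, with norm $\|\overrightarrow{A}\|_1=\max_{l=\pm1}|a_1(l)|$. For $n\ge2$, a directed set in $\mathbb{R}^n$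 is $\overrightarrow{A}=(\overrightarrow{A_{n-1}(l)},a_n(l))_{l\in S_{n-1}}$, where $a_n:S_{n-1}\to\mathbb{R}$ is continuous and $\overrightarrow{A_{n-1}}:S_{n-1}\to\mathcal{D}(\mathbb{R}^{n-1})$ is uniformly bounded with respect to $\|\cdot\|_{n-1}$; its norm is $\|\overrightarrow{A}\|_n=\max\{\sup_{l}\|\overrightarrow{A_{n-1}(l)}\|_{n-1},\max_l|a_n(l)|\}$. $\mathcal{D}(\mathbb{R}^n)$ is the set of directed sets in $\mathbb{R}^n$; addition, scalar multiplication and subtraction are defined componentwise (recursively). Embedding. $J_n:\mathcal{C}(\mathbb{R}^n)\to\mathcal{D}(\mathbb{R}^n)$ is given by $J_1([a,b])=(-a,b)$ (entries for $l=-1$ and $l=1$), and for $n\ge2$ by $J_n(A)=\big(J_{n-1}(\Pi_{n-1,l}(Y(l,A))),\delta^*(l,A)\big)_{l\in S_{n-1}}$. Quasidifferentiability. $f:\mathbb{R}^n\to\mathbb{R}$ is quasidifferentiable (QD) at $x$ if there are $\underline{\partial}f(x),\overline{\partial}f(x)\in\mathcal{C}(\mathbb{R}^n)$ with $f'(x;l)=\delta^*(l,\underline{\partial}f(x))-\delta^*(l,\ominus\overline{\partial}f(x))$ for all $l\in S_{n-1}$. Its directed subdifferential is $\overrightarrow{\partial}_{QD}f(x):=J_n(\underline{\partial}f(x))-J_n(\ominus\overline{\partial}f(x))$ (independent of the chosen pair of sets). *)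

theory Defs
  imports
    "HOL-Analysis.Abstract_Euclidean_Space"
    "HOL-Library.FuncSet"
    "Jordan_Normal_Form.VS_Connect"
begin

no_notation inner (infix \<open>\<bullet>\<close> 70)

text \<open>
  The dimension varies inside the definitions and inside the theorem, so vectors of
  \<open>\<real>\<^sup>n\<close> are elements of \<^term>\<open>carrier_vec n :: real vec set\<close>.  This type carries no
  topology; the Euclidean one is pulled back along the coordinate map.
\<close>

definition coords :: "real vec \<Rightarrow> nat \<Rightarrow> real" where
  "coords v = (\<lambda>i. if i < dim_vec v then v $ i else 0)"

definition vec_topology :: "nat \<Rightarrow> real vec topology" where
  "vec_topology n = pullback_topology (carrier_vec n) coords (Euclidean_space n)"

definition convex_vec :: "real vec set \<Rightarrow> bool" where
  "convex_vec C \<longleftrightarrow>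
    (\<forall>x\<in>C. \<forall>y\<in>C. \<forall>u\<ge>0. \<forall>v\<ge>0. u + v = 1 \<longrightarrow> u \<cdot>\<^sub>v x + v \<cdot>\<^sub>v y \<in> C)"

definition convex_bodies :: "nat \<Rightarrow> real vec set set" where
  "convex_bodies n = {C. C \<noteq> {} \<and> convex_vec C \<and> compactin (vec_topology n) C}"

definition unit_sphere :: "nat \<Rightarrow> real vec set" where
  "unit_sphere n = {l \<in> carrier_vec n. sqrt (l \<bullet> l) = 1}"

definition support_fun :: "real vec \<Rightarrow> real vec set \<Rightarrow> real" where
  "support_fun l C = (SUP c\<in>C. l \<bullet> c)"

definition support_face :: "real vec \<Rightarrow> real vec set \<Rightarrow> real vec set" where
  "support_face l C = {y \<in> C. l \<bullet> y = support_fun l C}"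

definition reflect :: "real vec set \<Rightarrow> real vec set" where
  "reflect C = uminus ` C"

definition has_dir_deriv :: "(real vec \<Rightarrow> real) \<Rightarrow> real vec \<Rightarrow> real vec \<Rightarrow> real \<Rightarrow> bool" where
  "has_dir_deriv f x l d \<longleftrightarrow> ((\<lambda>t. (f (x + t \<cdot>\<^sub>v l) - f x) / t) \<longlongrightarrow> d) (at_right 0)"

definition dir_deriv :: "(real vec \<Rightarrow> real) \<Rightarrow> real vec \<Rightarrow> real vec \<Rightarrow> real" where
  "dir_deriv f x l = Lim (at_right 0) (\<lambda>t. (f (x + t \<cdot>\<^sub>v l) - f x) / t)"

abbreviation vec_span :: "nat \<Rightarrow> real vec set \<Rightarrow> real vec set" where
  "vec_span n \<equiv> LinearCombinations.module.span class_ring (module_vec TYPE(real) n)"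

definition rotation_mat :: "nat \<Rightarrow> real mat \<Rightarrow> bool" where
  "rotation_mat n M \<longleftrightarrow>
    M \<in> carrier_mat n n \<and> transpose_mat M * M = 1\<^sub>m n \<and> det M = 1"

text \<open>
  Vectors and matrices are indexed from 0: \<open>e\<^sup>i\<close> is \<^term>\<open>unit_vec n (i - 1)\<close>.
\<close>

definition rotation_family :: "(nat \<Rightarrow> real vec \<Rightarrow> real mat) \<Rightarrow> bool" where
  "rotation_family R \<longleftrightarrow>
    (\<forall>n\<ge>2. \<forall>l\<in>unit_sphere n.
      rotation_mat n (R n l) \<and>
      R n l *\<^sub>v l = unit_vec n (n - 1) \<and>
      (\<lambda>v. R n l *\<^sub>v v) ` {v \<in> carrier_vec n. \<forall>w\<in>vec_span n {l}. v \<bullet> w = 0}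
        = vec_span n (unit_vec n ` {..<n - 1}))"

text \<open>\<open>drop_last n\<close> is \<open>\<pi>\<^bsub>n-1,n\<^esub>\<close> and \<open>Proj R n l\<close> is \<open>\<Pi>\<^bsub>n-1,l\<^esub>\<close>.\<close>

definition drop_last :: "nat \<Rightarrow> real mat" where
  "drop_last n = mat (n - 1) n (\<lambda>(i, j). if i = j then 1 else 0)"

definition Proj :: "(nat \<Rightarrow> real vec \<Rightarrow> real mat) \<Rightarrow> nat \<Rightarrow> real vec \<Rightarrow> real mat" where
  "Proj R n l = drop_last n * R n l"

text \<open>
  \<open>Segment a b\<close> stands for the pair with \<open>a\<^sub>1(-1) = a\<close> and \<open>a\<^sub>1(1) = b\<close>.
  In \<open>Family A a\<close> the functions are indexed by the unit sphere and, so that equality is equality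
  of families, they are \<^const>\<open>undefined\<close> elsewhere (hence the uses of \<^const>\<open>restrict\<close> below).
  The elements of \<open>\<D>(\<real>\<^sup>n)\<close> among all values of the datatype are singled out by \<open>directed_sets n\<close>.
\<close>

datatype dset =
    Segment real real
  | Family "real vec \<Rightarrow> dset" "real vec \<Rightarrow> real"

fun dnorm :: "nat \<Rightarrow> dset \<Rightarrow> real" where
  "dnorm (Suc 0) (Segment a b) = max \<bar>a\<bar> \<bar>b\<bar>"
| "dnorm (Suc (Suc m)) (Family A a) =
    max (SUP l\<in>unit_sphere (m + 2). dnorm (m + 1) (A l)) (SUP l\<in>unit_sphere (m + 2). \<bar>a l\<bar>)"

fun directed_sets :: "nat \<Rightarrow> dset set" where
  "directed_sets (Suc 0) = {Segment a b | a b. True}"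
| "directed_sets (Suc (Suc m)) =
    {Family A a | A a.
      A \<in> unit_sphere (m + 2) \<rightarrow>\<^sub>E directed_sets (m + 1) \<and>
      (\<exists>M. \<forall>l\<in>unit_sphere (m + 2). dnorm (m + 1) (A l) \<le> M) \<and>
      a \<in> extensional (unit_sphere (m + 2)) \<and>
      continuous_map (subtopology (vec_topology (m + 2)) (unit_sphere (m + 2))) euclideanreal a}"

fun dminus :: "nat \<Rightarrow> dset \<Rightarrow> dset \<Rightarrow> dset" where
  "dminus (Suc 0) (Segment a b) (Segment c d) = Segment (a - c) (b - d)"
| "dminus (Suc (Suc m)) (Family A a) (Family B b) =
    Family (\<lambda>l\<in>unit_sphere (m + 2). dminus (m + 1) (A l) (B l))
           (\<lambda>l\<in>unit_sphere (m + 2). a l - b l)"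

text \<open>
  In dimension 1 a convex body is the interval between the infimum and the supremum of its elements.
\<close>

fun embed :: "(nat \<Rightarrow> real vec \<Rightarrow> real mat) \<Rightarrow> nat \<Rightarrow> real vec set \<Rightarrow> dset" where
  "embed R (Suc 0) C = Segment (- (INF c\<in>C. c $ 0)) (SUP c\<in>C. c $ 0)"
| "embed R (Suc (Suc m)) C =
    Family
      (\<lambda>l\<in>unit_sphere (m + 2).
         embed R (m + 1) ((\<lambda>y. Proj R (m + 2) l *\<^sub>v y) ` support_face l C))
      (\<lambda>l\<in>unit_sphere (m + 2). support_fun l C)"

definition quasidiff_pair ::
  "nat \<Rightarrow> (real vec \<Rightarrow> real) \<Rightarrow> real vec \<Rightarrow> real vec set \<Rightarrow> real vec set \<Rightarrow> bool" where
  "quasidiff_pair n f x U V \<longleftrightarrow>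
    U \<in> convex_bodies n \<and> V \<in> convex_bodies n \<and>
    (\<forall>l\<in>unit_sphere n. has_dir_deriv f x l (support_fun l U - support_fun l (reflect V)))"

definition quasidifferentiable :: "nat \<Rightarrow> (real vec \<Rightarrow> real) \<Rightarrow> real vec \<Rightarrow> bool" where
  "quasidifferentiable n f x \<longleftrightarrow> (\<exists>U V. quasidiff_pair n f x U V)"

text \<open>
  The definite description expresses that the value does not depend on the choice of the pair.
\<close>

definition directed_subdiff ::
  "(nat \<Rightarrow> real vec \<Rightarrow> real mat) \<Rightarrow> nat \<Rightarrow> (real vec \<Rightarrow> real) \<Rightarrow> real vec \<Rightarrow> dset" where
  "directed_subdiff R n f x =
    (THE D. \<exists>U V. quasidiff_pair n f x U V \<and>
      D = dminus n (embed R n U) (embed R n (reflect V)))"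

text \<open>\<open>slice_deriv R n f x l\<close> is the function \<open>f\<^sub>l\<close> on \<open>\<real>\<^bsup>n-1\<^esup>\<close>.\<close>

definition slice_deriv ::
  "(nat \<Rightarrow> real vec \<Rightarrow> real mat) \<Rightarrow> nat \<Rightarrow> (real vec \<Rightarrow> real) \<Rightarrow> real vec \<Rightarrow> real vec
    \<Rightarrow> real vec \<Rightarrow> real" where
  "slice_deriv R n f x l = (\<lambda>y. dir_deriv f x (l + transpose_mat (Proj R n l) *\<^sub>v y))"

end

(* On the affine line through l in direction d, the support function of C is a maximum of affine
   functions of t, so by Danskin's theorem its right derivative at l is the support function of the
   face Y(l,C) in direction d.  With d = Pi^T y, the slice f_l therefore has at 0 the directional
   derivative in direction y given by the projected faces of the two bodies, which are exactly the components of
   the embedding in the next lower dimension.  The same computation, by induction on the dimension,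
   shows that the difference of two embedded bodies is determined by the difference of their support
   functions; this makes the definite description in the directed subdifferential well defined. *)

theory Submission
  imports Defs
begin

no_notation vec_nth (infixl \<open>$\<close> 90)

section \<open>Suprema over compact sets and Danskin's theorem in the plane\<close>

lemma Sup_image_attained:
  fixes f :: "'a \<Rightarrow> real"
  assumes "compact (f ` C)" "C \<noteq> {}"
  obtains c where "c \<in> C" "f c = (SUP c\<in>C. f c)" "\<And>c'. c' \<in> C \<Longrightarrow> f c' \<le> f c"
proof -
  obtain s where s: "s \<in> f ` C" "\<forall>t\<in>f ` C. t \<le> s"
    using compact_attains_sup[OF assms(1)] assms(2) by auto
  then obtain c where c: "c \<in> C" "s = f c" by blast
  have "Sup (f ` C) = f c"
    by (rule cSup_eq_maximum) (use s c in auto)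
  with that c s show thesis by auto
qed

text \<open>Danskin's theorem in two dimensions. It suffices for support functions, with \<open>S\<close> the image
  of the convex body under the functionals \<open>l\<close> and \<open>d\<close>.\<close>

lemma SUP_affine_right_derivative:
  fixes S :: "(real \<times> real) set"
  assumes S: "compact S" "S \<noteq> {}"
  defines "h \<equiv> \<lambda>t. SUP z\<in>S. fst z + t * snd z"
  shows "((\<lambda>t. (h t - h 0) / t) \<longlongrightarrow> (SUP z\<in>{z\<in>S. fst z = h 0}. snd z)) (at_right 0)"
proof -
  have cp: "compact ((\<lambda>z. fst z + t * snd z) ` S)" for t
    by (intro compact_continuous_image S continuous_intros)
  have h_ge: "fst z + t * snd z \<le> h t" if "z \<in> S" for z t
    using Sup_image_attained[OF cp[of t] S(2)] that unfolding h_def by metis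
  have h_att: "\<exists>z\<in>S. fst z + t * snd z = h t" for t
    using Sup_image_attained[OF cp[of t] S(2)] unfolding h_def by metis
  \<comment> \<open>\<open>F\<close> collects the maximizers at \<open>t = 0\<close>. It is compact,
    so it contains a point \<open>z0\<close> of largest slope, and this slope is the limit
    sought.\<close>
  define F where "F = {z\<in>S. fst z = h 0}"
  have "F = S \<inter> {z. fst z = h 0}"
    by (auto simp: F_def)
  moreover have "closed {z :: real \<times> real. fst z = h 0}"
    by (intro closed_Collect_eq continuous_intros)
  ultimately have "compact F"
    using S(1) compact_Int_closed by metis
  then have cF: "compact (snd ` F)"
    by (intro compact_continuous_image continuous_intros)
  have "F \<noteq> {}"
    using h_att[of 0] by (auto simp: F_def)
  then obtain z0 where z0: "z0 \<in> F" "snd z0 = (SUP z\<in>F. snd z)"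
      "\<And>z. z \<in> F \<Longrightarrow> snd z \<le> snd z0"
    using Sup_image_attained[OF cF] by metis
  then have z0S: "z0 \<in> S" "fst z0 = h 0"
    by (auto simp: F_def)
  have "bounded (snd ` S)"
    by (intro compact_imp_bounded compact_continuous_image continuous_intros S)
  then obtain B where B: "\<And>z. z \<in> S \<Longrightarrow> \<bar>snd z\<bar> \<le> B" and "B > 0"
    by (auto simp: bounded_pos)
  have "((\<lambda>t. (h t - h 0) / t) \<longlongrightarrow> snd z0) (at_right 0)"
  proof (rule order_tendstoI)
    fix a assume a: "a < snd z0"
    show "\<forall>\<^sub>F t in at_right 0. a < (h t - h 0) / t"
      using eventually_at_right_less[of 0]
    proof eventually_elim
      case (elim t)
      \<comment> \<open>Lower bound: \<open>z0\<close> competes in the supremum \<open>h t\<close>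
        for every \<open>t\<close>.\<close>
      have "t * a < t * snd z0"
        using a elim by simp
      also have "\<dots> \<le> h t - h 0"
        using h_ge[of z0 t] z0S by simp
      finally show ?case
        using elim by (simp add: field_simps)
    qed
  next
    fix a assume a: "snd z0 < a"
    \<comment> \<open>Upper bound: points of slope at least \<open>a\<close> lie outside
      \<open>F\<close>, since slopes on \<open>F\<close> are at most \<open>snd z0\<close>. As
      \<open>K\<close> is compact, \<open>fst\<close> stays below \<open>h 0\<close> on it by a
      uniform gap \<open>g\<close>; any positive \<open>g\<close> serves when \<open>K\<close> is
      empty.\<close>
    define K where "K = S \<inter> {z. a \<le> snd z}"
    have "compact K"
      unfolding K_def by (intro compact_Int_closed S closed_Collect_le continuous_intros)
    then have cK: "compact (fst ` K)"
      by (intro compact_continuous_image continuous_intros)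
    have K_less: "fst z < h 0" if "z \<in> K" for z
    proof -
      have "z \<in> S" "a \<le> snd z"
        using that by (auto simp: K_def)
      then have "fst z \<le> h 0" "z \<notin> F"
        using h_ge[of z 0] z0(3)[of z] a by auto
      with \<open>z \<in> S\<close> show ?thesis
        by (auto simp: F_def)
    qed
    obtain g where g: "g > 0" "\<And>z. z \<in> K \<Longrightarrow> fst z \<le> h 0 - g"
    proof (cases "K = {}")
      case True
      then show thesis using that[of 1] by auto
    next
      case False
      then obtain c where c: "c \<in> K" "\<And>z. z \<in> K \<Longrightarrow> fst z \<le> fst c"
        using Sup_image_attained[OF cK] by metis
      show thesis
        by (rule that[of "h 0 - fst c"]) (use c K_less[of c] in auto)
    qed
    \<comment> \<open>For such \<open>t\<close> no maximizer lies in \<open>K\<close>: there the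
      value is at most \<open>h 0 - g + t * B\<close>, whereas \<open>z0\<close> already gives at
      least \<open>h 0 - t * B\<close>.\<close>
    have "\<forall>\<^sub>F t in at_right 0. t < g / (2 * B)"
      by (rule eventually_at_rightI[of _ "g / (2 * B)"]) (use g \<open>B > 0\<close> in auto)
    then show "\<forall>\<^sub>F t in at_right 0. (h t - h 0) / t < a"
      using eventually_at_right_less[of 0]
    proof eventually_elim
      case (elim t)
      obtain z where z: "z \<in> S" "fst z + t * snd z = h t"
        using h_att by blast
      have "z \<notin> K"
      proof
        assume "z \<in> K"
        then have "h t \<le> h 0 - g + t * snd z"
          using g(2) z by fastforce
        moreover have "t * snd z \<le> t * B"
          using B[OF z(1)] elim by (intro mult_left_mono) auto
        moreover have "t * (- B) \<le> t * snd z0"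
          using B[OF z0S(1)] elim by (intro mult_left_mono) auto
        moreover have "h 0 + t * snd z0 \<le> h t"
          using h_ge[OF z0S(1), of t] z0S by simp
        moreover have "2 * (t * B) < g"
          using elim \<open>B > 0\<close> by (simp add: field_simps)
        ultimately show False by linarith
      qed
      \<comment> \<open>Every maximizer at \<open>t\<close> thus has slope below \<open>a\<close>
        and starts at height at most \<open>h 0\<close>, which bounds the increment by
        \<open>t * a\<close>.\<close>
      then have "snd z < a"
        using z by (auto simp: K_def)
      then have "t * snd z < t * a"
        using elim by simp
      moreover have "fst z \<le> h 0"
        using h_ge[OF z(1), of 0] by simp
      ultimately have "h t - h 0 < t * a"
        using z by linarith
      then show ?case
        using elim by (simp add: field_simps)
    qed
  qed
  then show ?thesis
    using z0(2) by (simp add: F_def)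
qed

section \<open>Topology on \<open>carrier_vec n\<close> and operations on convex bodies\<close>

lemma topspace_vec_topology: "topspace (vec_topology n) = carrier_vec n"
  by (auto simp: vec_topology_def topspace_pullback_topology topspace_Euclidean_space coords_def)

lemma continuous_map_vec_index:
  assumes "i < n"
  shows "continuous_map (vec_topology n) euclideanreal (\<lambda>v. v $ i)"
proof -
  have "continuous_map (Euclidean_space n) euclideanreal (\<lambda>x. x i)"
    unfolding Euclidean_space_def
    by (intro continuous_map_from_subtopology continuous_map_product_projection) auto
  then have "continuous_map (vec_topology n) euclideanreal ((\<lambda>x. x i) \<circ> coords)"
    unfolding vec_topology_def by (rule continuous_map_pullback)
  then show ?thesis
    by (rule continuous_map_eq) (use assms in \<open>auto simp: topspace_vec_topology coords_def\<close>)
qed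

lemma continuous_map_scalar_prod:
  "continuous_map (vec_topology n) euclideanreal (\<lambda>v. l \<bullet> v)"
proof -
  have "continuous_map (vec_topology n) euclideanreal (\<lambda>v. \<Sum>i\<in>{0..<n}. l $ i * v $ i)"
    by (intro continuous_intros continuous_map_vec_index) auto
  then show ?thesis
    by (rule continuous_map_eq) (auto simp: topspace_vec_topology scalar_prod_def)
qed

text \<open>Continuity into a pullback topology is tested after composing with
  \<open>coords\<close>, one coordinate at a time. Each coordinate is a scalar product with a row,
  or constantly 0 from index \<open>m\<close> on.\<close>

lemma continuous_map_mult_mat_vec:
  assumes "A \<in> carrier_mat m n"
  shows "continuous_map (vec_topology n) (vec_topology m) (\<lambda>v. A *\<^sub>v v)"
  unfolding vec_topology_def[of m]
proof (rule continuous_map_pullback')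
  have "continuous_map (vec_topology n) euclideanreal (\<lambda>v. coords (A *\<^sub>v v) i)" for i
    using assms continuous_map_scalar_prod[of n "row A i"]
    by (cases "i < m") (auto simp: coords_def)
  then show "continuous_map (vec_topology n) (Euclidean_space m) (coords \<circ> (\<lambda>v. A *\<^sub>v v))"
    using assms
    by (auto simp: Euclidean_space_def continuous_map_in_subtopology
        continuous_map_componentwise_UNIV coords_def)
  show "topspace (vec_topology n) \<subseteq> (\<lambda>v. A *\<^sub>v v) -` carrier_vec m"
    using assms by (auto simp: topspace_vec_topology)
qed

lemma convex_bodies_subset_carrier: "C \<in> convex_bodies n \<Longrightarrow> C \<subseteq> carrier_vec n"
  using compactin_subset_topspace[of "vec_topology n" C]
  by (auto simp: convex_bodies_def topspace_vec_topology)

lemma compact_image_convex_body: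
  assumes "C \<in> convex_bodies n" "continuous_map (vec_topology n) euclidean f"
  shows "compact (f ` C)"
  using image_compactin[of "vec_topology n" C euclidean f] assms
  by (auto simp: convex_bodies_def)

lemma support_fun_attained:
  assumes "C \<in> convex_bodies n"
  obtains c where "c \<in> C" "l \<bullet> c = support_fun l C" "\<And>c'. c' \<in> C \<Longrightarrow> l \<bullet> c' \<le> l \<bullet> c"
  using Sup_image_attained[OF compact_image_convex_body[OF assms continuous_map_scalar_prod[of n l]]] assms
  unfolding support_fun_def convex_bodies_def by blast

lemma mult_mat_vec_convex_bodies:
  assumes A: "A \<in> carrier_mat m n" and C: "C \<in> convex_bodies n"
  shows "(\<lambda>v. A *\<^sub>v v) ` C \<in> convex_bodies m"
proof -
  have "convex_vec ((\<lambda>v. A *\<^sub>v v) ` C)"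
    unfolding convex_vec_def
  proof clarify
    fix x y u v assume xy: "x \<in> C" "y \<in> C" and uv: "0 \<le> (u::real)" "0 \<le> v" "u + v = 1"
    then have "u \<cdot>\<^sub>v x + v \<cdot>\<^sub>v y \<in> C"
      using C by (auto simp: convex_bodies_def convex_vec_def)
    moreover have "A *\<^sub>v (u \<cdot>\<^sub>v x + v \<cdot>\<^sub>v y) = u \<cdot>\<^sub>v (A *\<^sub>v x) + v \<cdot>\<^sub>v (A *\<^sub>v y)"
      using A xy convex_bodies_subset_carrier[OF C]
      by (subst mult_add_distrib_mat_vec[OF A]) (auto simp: mult_mat_vec[OF A] subset_iff)
    ultimately show "u \<cdot>\<^sub>v (A *\<^sub>v x) + v \<cdot>\<^sub>v (A *\<^sub>v y) \<in> (\<lambda>v. A *\<^sub>v v) ` C"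
      by (metis imageI)
  qed
  then show ?thesis
    using C image_compactin[OF _ continuous_map_mult_mat_vec[OF A], of C]
    by (auto simp: convex_bodies_def)
qed

text \<open>The face is the intersection of \<open>C\<close> with a closed hyperplane, and it is
  nonempty because the maximum is attained. This keeps the recursion of \<open>embed\<close> inside
  the convex bodies.\<close>

lemma support_face_convex_bodies:
  assumes C: "C \<in> convex_bodies n" and l: "l \<in> carrier_vec n"
  shows "support_face l C \<in> convex_bodies n"
proof -
  note sub = convex_bodies_subset_carrier[OF C]
  have "closedin (vec_topology n) {y \<in> topspace (vec_topology n). l \<bullet> y \<in> {support_fun l C}}"
    by (rule closedin_continuous_map_preimage[OF continuous_map_scalar_prod]) simp
  then have "compactin (vec_topology n)
      ({y \<in> topspace (vec_topology n). l \<bullet> y \<in> {support_fun l C}} \<inter> C)"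
    using C by (intro closed_Int_compactin) (auto simp: convex_bodies_def)
  moreover have "{y \<in> topspace (vec_topology n). l \<bullet> y \<in> {support_fun l C}} \<inter> C = support_face l C"
    using sub by (auto simp: topspace_vec_topology support_face_def)
  moreover have "support_face l C \<noteq> {}"
    using support_fun_attained[OF C, of l] by (auto simp: support_face_def)
  moreover have "convex_vec (support_face l C)"
    unfolding convex_vec_def
  proof (intro ballI allI impI)
    fix x y u v assume "x \<in> support_face l C" "y \<in> support_face l C"
      and uv: "0 \<le> (u::real)" "0 \<le> v" "u + v = 1"
    then have xy: "x \<in> C" "y \<in> C" "l \<bullet> x = support_fun l C" "l \<bullet> y = support_fun l C"
      by (auto simp: support_face_def)
    have "u \<cdot>\<^sub>v x + v \<cdot>\<^sub>v y \<in> C"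
      using C xy uv by (auto simp: convex_bodies_def convex_vec_def)
    moreover have "l \<bullet> (u \<cdot>\<^sub>v x + v \<cdot>\<^sub>v y) = u * (l \<bullet> x) + v * (l \<bullet> y)"
      using xy sub l by (subst scalar_prod_add_distrib[of _ n]) (auto simp: subset_iff)
    then have "l \<bullet> (u \<cdot>\<^sub>v x + v \<cdot>\<^sub>v y) = support_fun l C"
      using xy uv by (simp flip: distrib_right)
    ultimately show "u \<cdot>\<^sub>v x + v \<cdot>\<^sub>v y \<in> support_face l C"
      by (simp add: support_face_def)
  qed
  ultimately show ?thesis
    by (simp add: convex_bodies_def)
qed

text \<open>Reflection is the linear map with matrix \<open>- 1\<^sub>m n\<close>, so the result on
  linear images applies.\<close>

lemma reflect_convex_bodies:
  assumes C: "C \<in> convex_bodies n"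
  shows "reflect C \<in> convex_bodies n"
proof -
  have "- v = - 1\<^sub>m n *\<^sub>v v" if "v \<in> C" for v
    using that convex_bodies_subset_carrier[OF C]
    by (intro eq_vecI) (auto simp: subset_iff)
  then have "reflect C = (\<lambda>v. - 1\<^sub>m n *\<^sub>v v) ` C"
    by (auto simp: reflect_def image_def)
  then show ?thesis
    using mult_mat_vec_convex_bodies[OF _ C, of "- 1\<^sub>m n" n] by simp
qed

lemma reflect_reflect: "reflect (reflect C) = C"
  by (auto simp: reflect_def image_image)

section \<open>Support functions and their one-sided derivatives\<close>

lemma support_fun_smult:
  assumes C: "C \<in> convex_bodies n" and l: "l \<in> carrier_vec n" and s: "s \<ge> 0"
  shows "support_fun (s \<cdot>\<^sub>v l) C = s * support_fun l C"
proof -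
  obtain c where c: "c \<in> C" "l \<bullet> c = support_fun l C" "\<And>c'. c' \<in> C \<Longrightarrow> l \<bullet> c' \<le> l \<bullet> c"
    using support_fun_attained[OF C] by metis
  have eq: "(s \<cdot>\<^sub>v l) \<bullet> c' = s * (l \<bullet> c')" if "c' \<in> C" for c'
    using that l convex_bodies_subset_carrier[OF C] by (intro smult_scalar_prod_distrib) auto
  have "support_fun (s \<cdot>\<^sub>v l) C = (s \<cdot>\<^sub>v l) \<bullet> c"
    unfolding support_fun_def
    by (rule cSup_eq_maximum) (use c s eq in \<open>auto intro!: mult_left_mono image_eqI[of _ _ c]\<close>)
  then show ?thesis
    using c eq by simp
qed

text \<open>Adjointness moves the matrix from the body to the direction; for
  \<open>Proj R n l\<close> this trades a projected face for a lifted direction.\<close>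

lemma support_fun_mult_mat_vec:
  assumes A: "A \<in> carrier_mat m n" and "C \<subseteq> carrier_vec n" and "l \<in> carrier_vec m"
  shows "support_fun l ((\<lambda>v. A *\<^sub>v v) ` C) = support_fun (transpose_mat A *\<^sub>v l) C"
  unfolding support_fun_def image_image
  by (rule SUP_cong) (use assms in \<open>auto simp: transpose_vec_mult_scalar[OF A]\<close>)

lemma zero_smult_vec: "v \<in> carrier_vec n \<Longrightarrow> (0 :: real) \<cdot>\<^sub>v v = 0\<^sub>v n"
  by auto

text \<open>Along the line \<open>l + t d\<close> only the two numbers that \<open>l\<close> and
  \<open>d\<close> assign to a point of \<open>C\<close> matter, so the planar Danskin theorem
  applies to the compact image \<open>S\<close>.\<close>

lemma support_fun_right_derivative:
  assumes C: "C \<in> convex_bodies n" and l: "l \<in> carrier_vec n" and d: "d \<in> carrier_vec n"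
  shows "((\<lambda>t. (support_fun (l + t \<cdot>\<^sub>v d) C - support_fun l C) / t) \<longlongrightarrow>
    support_fun d (support_face l C)) (at_right 0)"
proof -
  define S where "S = (\<lambda>c. (l \<bullet> c, d \<bullet> c)) ` C"
  have "continuous_map (vec_topology n) euclidean (\<lambda>c. (l \<bullet> c, d \<bullet> c))"
    using continuous_map_pairedI[OF continuous_map_scalar_prod[of n l] continuous_map_scalar_prod[of n d]]
    by simp
  then have "compact S"
    unfolding S_def by (rule compact_image_convex_body[OF C])
  moreover have "S \<noteq> {}"
    using C by (auto simp: S_def convex_bodies_def)
  moreover have eq: "(SUP z\<in>S. fst z + t * snd z) = support_fun (l + t \<cdot>\<^sub>v d) C" for t
    unfolding S_def support_fun_def image_image
    using l d convex_bodies_subset_carrier[OF C]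
    by (intro SUP_cong) (auto simp: add_scalar_prod_distrib[of _ n] subset_iff)
  have eq0: "l + 0 \<cdot>\<^sub>v d = l"
    using l d by (simp add: zero_smult_vec)
  \<comment> \<open>The maximizers at \<open>t = 0\<close> in \<open>S\<close> are the images of the
    points of the face.\<close>
  have "snd ` {z\<in>S. fst z = support_fun l C} = (\<lambda>c. d \<bullet> c) ` support_face l C"
    by (force simp: S_def support_face_def)
  then have "(SUP z\<in>{z\<in>S. fst z = support_fun l C}. snd z) = support_fun d (support_face l C)"
    by (simp add: support_fun_def)
  ultimately show ?thesis
    using SUP_affine_right_derivative[of S] by (simp only: eq eq0 simp_thms)
qed


lemma support_fun_diff_right_derivative:
  assumes "C \<in> convex_bodies n" "D \<in> convex_bodies n" "l \<in> carrier_vec n" "d \<in> carrier_vec n"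
  shows "((\<lambda>t. ((support_fun (l + t \<cdot>\<^sub>v d) C - support_fun (l + t \<cdot>\<^sub>v d) D)
      - (support_fun l C - support_fun l D)) / t) \<longlongrightarrow>
    support_fun d (support_face l C) - support_fun d (support_face l D)) (at_right 0)"
  using tendsto_diff[OF support_fun_right_derivative[OF assms(1,3,4)]
      support_fun_right_derivative[OF assms(2,3,4)]]
  by (rule back_subst[of "\<lambda>g. (g \<longlongrightarrow> _) _"]) (auto simp: diff_divide_distrib)

section \<open>Passing from the unit sphere to all directions by positive homogeneity\<close>

lemma carrier_vec_polar:
  assumes v: "v \<in> carrier_vec n" and "n \<ge> 1"
  obtains s l where "s \<ge> 0" "l \<in> unit_sphere n" "v = s \<cdot>\<^sub>v l"
proof (cases "v = 0\<^sub>v n")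
  case True
  \<comment> \<open>The zero vector determines no direction; with \<open>s = 0\<close> any unit
    vector will do, and \<open>n \<ge> 1\<close> provides \<open>unit_vec n 0\<close>.\<close>
  then show thesis
    using that[of 0 "unit_vec n 0"] assms by (auto simp: unit_sphere_def zero_smult_vec[of _ n])
next
  case False
  have sq: "v \<bullet> v = (\<Sum>i\<in>{0..<n}. (v $ i)\<^sup>2)"
    using v by (auto simp: scalar_prod_def power2_eq_square)
  then have "v \<bullet> v \<noteq> 0"
    using False v by (auto simp: sum_nonneg_eq_0_iff intro!: eq_vecI)
  then have pos: "v \<bullet> v > 0"
    unfolding sq by (simp add: less_le sum_nonneg)
  define s where "s = sqrt (v \<bullet> v)"
  have s: "s > 0" "s * s = v \<bullet> v"
    using pos by (auto simp: s_def)
  have "(inverse s \<cdot>\<^sub>v v) \<bullet> (inverse s \<cdot>\<^sub>v v) = inverse s * (inverse s * (s * s))"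
    using v s by (subst smult_scalar_prod_distrib) auto
  also have "\<dots> = 1"
    using s(1) by (simp add: field_simps)
  finally show thesis
    using that[of s "inverse s \<cdot>\<^sub>v v"] s v by (auto simp: unit_sphere_def smult_smult_assoc)
qed

lemma dir_deriv_eq: "has_dir_deriv f x l d \<Longrightarrow> dir_deriv f x l = d"
  unfolding has_dir_deriv_def dir_deriv_def by (rule tendsto_Lim) simp

lemma has_dir_deriv_unique:
  "has_dir_deriv f x l d \<Longrightarrow> has_dir_deriv f x l d' \<Longrightarrow> d = d'"
  using dir_deriv_eq by blast

lemma has_dir_deriv_smult:
  assumes f: "has_dir_deriv f x l d" and "x \<in> carrier_vec n" "l \<in> carrier_vec n" "s \<ge> 0"
  shows "has_dir_deriv f x (s \<cdot>\<^sub>v l) (s * d)"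
proof (cases "s = 0")
  case True
  have "x + t \<cdot>\<^sub>v (0 \<cdot>\<^sub>v l) = x" for t
    using assms by (intro eq_vecI) auto
  then show ?thesis
    using True by (simp add: has_dir_deriv_def)
next
  case False
  with \<open>s \<ge> 0\<close> have s: "s > 0" by simp
  \<comment> \<open>The substitution of \<open>t * s\<close> for \<open>t\<close> preserves the
    approach to 0 from the right because \<open>s > 0\<close>.\<close>
  have "filterlim (\<lambda>t. t * s) (at_right 0) (at_right 0)"
    using filterlim_times_pos[OF filterlim_ident s, of 0 0] by (simp add: mult.commute)
  then have "((\<lambda>t. (f (x + (t * s) \<cdot>\<^sub>v l) - f x) / (t * s)) \<longlongrightarrow> d) (at_right 0)"
    using f unfolding has_dir_deriv_def by (rule filterlim_compose[rotated])
  then have "((\<lambda>t. s * ((f (x + (t * s) \<cdot>\<^sub>v l) - f x) / (t * s))) \<longlongrightarrow> s * d) (at_right 0)"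
    by (rule tendsto_mult_left)
  then show ?thesis
    using s by (simp add: has_dir_deriv_def smult_smult_assoc)
qed

text \<open>Differentiating at \<open>l\<close> requires the equality at the points
  \<open>l + t e\<close>, which in general leave the sphere.\<close>

lemma support_fun_diff_cong:
  assumes "A \<in> convex_bodies n" "B \<in> convex_bodies n" "C \<in> convex_bodies n" "D \<in> convex_bodies n"
    and "n \<ge> 1" and v: "v \<in> carrier_vec n"
    and eq: "\<And>l. l \<in> unit_sphere n \<Longrightarrow>
      support_fun l A - support_fun l B = support_fun l C - support_fun l D"
  shows "support_fun v A - support_fun v B = support_fun v C - support_fun v D"
proof -
  obtain s l where sl: "s \<ge> 0" "l \<in> unit_sphere n" "v = s \<cdot>\<^sub>v l"
    using carrier_vec_polar[OF v \<open>n \<ge> 1\<close>] by blast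
  then have "l \<in> carrier_vec n"
    by (simp add: unit_sphere_def)
  then show ?thesis
    using eq[OF sl(2)] sl assms(1-4) by (simp add: support_fun_smult flip: right_diff_distrib)
qed

text \<open>The slice functions evaluate the directional derivative at vectors off the sphere, where
  the definition of a quasidifferential pair says nothing directly.\<close>

lemma quasidiff_pair_has_dir_deriv:
  assumes q: "quasidiff_pair n f x U V" and "n \<ge> 1" "x \<in> carrier_vec n" and v: "v \<in> carrier_vec n"
  shows "has_dir_deriv f x v (support_fun v U - support_fun v (reflect V))"
proof -
  obtain s l where sl: "s \<ge> 0" "l \<in> unit_sphere n" "v = s \<cdot>\<^sub>v l"
    using carrier_vec_polar[OF v \<open>n \<ge> 1\<close>] by blast
  then have l: "l \<in> carrier_vec n"
    by (simp add: unit_sphere_def)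
  have U: "U \<in> convex_bodies n" "reflect V \<in> convex_bodies n"
    using q by (auto simp: quasidiff_pair_def reflect_convex_bodies)
  have "has_dir_deriv f x l (support_fun l U - support_fun l (reflect V))"
    using q sl by (simp add: quasidiff_pair_def)
  from has_dir_deriv_smult[OF this \<open>x \<in> carrier_vec n\<close> l sl(1)]
  show ?thesis
    using sl l U by (simp add: support_fun_smult right_diff_distrib)
qed

section \<open>Projected faces\<close>

lemma Proj_carrier:
  assumes "rotation_family R" "n \<ge> 2" "l \<in> unit_sphere n"
  shows "Proj R n l \<in> carrier_mat (n - 1) n"
proof -
  have "R n l \<in> carrier_mat n n"
    using assms by (auto simp: rotation_family_def rotation_mat_def)
  then show ?thesis
    by (auto simp: Proj_def drop_last_def)
qed

abbreviation projected_face ::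
  "(nat \<Rightarrow> real vec \<Rightarrow> real mat) \<Rightarrow> nat \<Rightarrow> real vec \<Rightarrow> real vec set \<Rightarrow> real vec set" where
  "projected_face R n l C \<equiv> (\<lambda>y. Proj R n l *\<^sub>v y) ` support_face l C"

lemma projected_face_convex_bodies:
  assumes "rotation_family R" "n \<ge> 2" "l \<in> unit_sphere n" "C \<in> convex_bodies n"
  shows "projected_face R n l C \<in> convex_bodies (n - 1)"
  using assms
  by (intro mult_mat_vec_convex_bodies[OF Proj_carrier] support_face_convex_bodies)
    (auto simp: unit_sphere_def)

text \<open>Stated for a difference because only the difference of the two support functions is
  prescribed, both when comparing pairs and when differentiating a slice.\<close>

lemma projected_face_diff_right_derivative:
  assumes R: "rotation_family R" "n \<ge> 2" "l \<in> unit_sphere n"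
    and C: "C \<in> convex_bodies n" and D: "D \<in> convex_bodies n" and d: "d \<in> carrier_vec (n - 1)"
  defines "e \<equiv> transpose_mat (Proj R n l) *\<^sub>v d"
  shows "((\<lambda>t. ((support_fun (l + t \<cdot>\<^sub>v e) C - support_fun (l + t \<cdot>\<^sub>v e) D)
      - (support_fun l C - support_fun l D)) / t) \<longlongrightarrow>
    support_fun d (projected_face R n l C) - support_fun d (projected_face R n l D)) (at_right 0)"
proof -
  note P = Proj_carrier[OF R]
  have l: "l \<in> carrier_vec n"
    using R by (simp add: unit_sphere_def)
  have e: "e \<in> carrier_vec n"
    using P d by (simp add: e_def)
  have "support_fun d (projected_face R n l X) = support_fun e (support_face l X)"
    if "X \<in> convex_bodies n" for X
    unfolding e_def
    using convex_bodies_subset_carrier[OF support_face_convex_bodies[OF that l]]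
    by (intro support_fun_mult_mat_vec[OF P] d)
  then show ?thesis
    using support_fun_diff_right_derivative[OF C D l e] C D by simp
qed

section \<open>The embedding, the directed subdifferential and its slices\<close>

lemma embed_1:
  assumes C: "C \<in> convex_bodies 1"
  shows "embed R 1 C = Segment (support_fun (- unit_vec 1 0) C) (support_fun (unit_vec 1 0) C)"
proof -
  have c: "- unit_vec 1 0 \<bullet> c = - (c $ 0)" "unit_vec 1 0 \<bullet> c = c $ 0" if "c \<in> C" for c
  proof -
    have "c \<in> carrier_vec 1"
      using that convex_bodies_subset_carrier[OF C] by blast
    then show "- unit_vec 1 0 \<bullet> c = - (c $ 0)" "unit_vec 1 0 \<bullet> c = c $ 0"
      by (simp_all add: scalar_prod_def)
  qed
  have "support_fun (- unit_vec 1 0) C = (SUP c\<in>C. - (c $ 0))"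
    unfolding support_fun_def by (rule SUP_cong[OF refl c(1)])
  moreover have "support_fun (unit_vec 1 0) C = (SUP c\<in>C. c $ 0)"
    unfolding support_fun_def by (rule SUP_cong[OF refl c(2)])
  \<comment> \<open>The negated infimum is the support value in direction -1, so both entries are
    values of the support function.\<close>
  moreover have "- (INF c\<in>C. c $ 0) = (SUP c\<in>C. - (c $ 0))"
    by (simp only: Inf_real_def image_image minus_minus)
  ultimately show ?thesis
    by (simp only: One_nat_def embed.simps)
qed

lemma dminus_1: "dminus 1 (Segment a b) (Segment c d) = Segment (a - c) (b - d)"
  by simp

lemma unit_vec_1_unit_sphere: "unit_vec 1 0 \<in> unit_sphere 1" "- unit_vec 1 0 \<in> unit_sphere 1"
  by (auto simp: unit_sphere_def scalar_prod_def)

text \<open>Induction on the dimension: the real components agree by hypothesis, and the projected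
  faces inherit the hypothesis because their support differences are right derivatives of equal
  functions.\<close>

lemma dminus_embed_cong:
  assumes "rotation_family R" "n \<ge> 1"
    and "A \<in> convex_bodies n" "B \<in> convex_bodies n" "C \<in> convex_bodies n" "D \<in> convex_bodies n"
    and "\<And>l. l \<in> unit_sphere n \<Longrightarrow>
      support_fun l A - support_fun l B = support_fun l C - support_fun l D"
  shows "dminus n (embed R n A) (embed R n B) = dminus n (embed R n C) (embed R n D)"
  using assms(2-)
proof (induction n arbitrary: A B C D rule: nat_induct_at_least)
  case base
  then show ?case
    using unit_vec_1_unit_sphere by (simp add: embed_1 dminus_1 del: One_nat_def)
next
  case (Suc n)
  \<comment> \<open>This exposes the dimension as \<open>Suc (Suc m)\<close>, the form matched by
    the recursive equations of \<open>embed\<close> and \<open>dminus\<close>.\<close>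
  obtain m where n: "n = Suc m"
    using Suc.hyps by (cases n) auto
  have "dminus n (embed R n (projected_face R (Suc n) l A)) (embed R n (projected_face R (Suc n) l B))
      = dminus n (embed R n (projected_face R (Suc n) l C)) (embed R n (projected_face R (Suc n) l D))"
    if l: "l \<in> unit_sphere (Suc n)" for l
  proof (rule Suc.IH)
    fix d assume "d \<in> unit_sphere n"
    then have d: "d \<in> carrier_vec (Suc n - 1)"
      by (simp add: unit_sphere_def)
    have n2: "Suc n \<ge> 2"
      using Suc.hyps by simp
    define e where "e = transpose_mat (Proj R (Suc n) l) *\<^sub>v d"
    have "l \<in> carrier_vec (Suc n)" "e \<in> carrier_vec (Suc n)"
      using l d Proj_carrier[OF assms(1) n2 l] by (auto simp: unit_sphere_def e_def)
    then have eq: "support_fun (l + t \<cdot>\<^sub>v e) A - support_fun (l + t \<cdot>\<^sub>v e) B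
        = support_fun (l + t \<cdot>\<^sub>v e) C - support_fun (l + t \<cdot>\<^sub>v e) D" for t
      by (intro support_fun_diff_cong[OF Suc.prems(1-4) _ _ Suc.prems(5)]) auto
    show "support_fun d (projected_face R (Suc n) l A) - support_fun d (projected_face R (Suc n) l B)
        = support_fun d (projected_face R (Suc n) l C) - support_fun d (projected_face R (Suc n) l D)"
      \<comment> \<open>After rewriting with \<open>eq\<close>, both facts concern the same
        difference quotient, whose limit is unique.\<close>
      using projected_face_diff_right_derivative[OF assms(1) n2 l Suc.prems(1,2) d]
        projected_face_diff_right_derivative[OF assms(1) n2 l Suc.prems(3,4) d]
      unfolding e_def[symmetric] eq Suc.prems(5)[OF l]
      by (rule tendsto_unique[OF trivial_limit_at_right_real])
  qed (use projected_face_convex_bodies[OF assms(1) _ l] Suc.hyps Suc.prems in auto)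
  then show ?case
    using Suc.prems(5) by (auto simp: n fun_eq_iff)
qed

text \<open>Any two pairs represent the same directional derivative on the sphere, hence give the
  same difference of embeddings; this is the uniqueness required by \<open>THE\<close>.\<close>

lemma directed_subdiff_eq:
  assumes R: "rotation_family R" and n: "n \<ge> 1" and q: "quasidiff_pair n f x U V"
  shows "directed_subdiff R n f x = dminus n (embed R n U) (embed R n (reflect V))"
  unfolding directed_subdiff_def
proof (rule the_equality)
  fix D
  assume "\<exists>U V. quasidiff_pair n f x U V \<and> D = dminus n (embed R n U) (embed R n (reflect V))"
  then obtain U' V' where q': "quasidiff_pair n f x U' V'"
    and D: "D = dminus n (embed R n U') (embed R n (reflect V'))"
    by blast
  show "D = dminus n (embed R n U) (embed R n (reflect V))"
    unfolding D
  proof (rule dminus_embed_cong[OF R n])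
    fix l assume "l \<in> unit_sphere n"
    then show "support_fun l U' - support_fun l (reflect V') = support_fun l U - support_fun l (reflect V)"
      using q q' has_dir_deriv_unique unfolding quasidiff_pair_def by metis
  qed (use q q' in \<open>auto simp: quasidiff_pair_def reflect_convex_bodies\<close>)
qed (use q in blast)

text \<open>The second set is reflected here because \<open>quasidiff_pair\<close> reflects it once
  more; the two reflections cancel.\<close>

lemma quasidiff_pair_slice_deriv:
  assumes R: "rotation_family R" "n \<ge> 2" "l \<in> unit_sphere n"
    and x: "x \<in> carrier_vec n" and q: "quasidiff_pair n f x U V"
  shows "quasidiff_pair (n - 1) (slice_deriv R n f x l) (0\<^sub>v (n - 1))
    (projected_face R n l U) (reflect (projected_face R n l (reflect V)))"
proof -
  have U: "U \<in> convex_bodies n" "reflect V \<in> convex_bodies n"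
    using q by (auto simp: quasidiff_pair_def reflect_convex_bodies)
  note P = Proj_carrier[OF R]
  have l: "l \<in> carrier_vec n"
    using R by (simp add: unit_sphere_def)
  have "has_dir_deriv (slice_deriv R n f x l) (0\<^sub>v (n - 1)) d
      (support_fun d (projected_face R n l U) - support_fun d (projected_face R n l (reflect V)))"
    if "d \<in> unit_sphere (n - 1)" for d
  proof -
    have d: "d \<in> carrier_vec (n - 1)"
      using that by (simp add: unit_sphere_def)
    define e where "e = transpose_mat (Proj R n l) *\<^sub>v d"
    have e: "e \<in> carrier_vec n"
      using P d by (simp add: e_def)
    have f': "dir_deriv f x v = support_fun v U - support_fun v (reflect V)"
      if "v \<in> carrier_vec n" for v
      using quasidiff_pair_has_dir_deriv[OF q _ x that] R(2) by (intro dir_deriv_eq) auto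
    have te: "transpose_mat (Proj R n l) *\<^sub>v (0\<^sub>v (n - 1) + t \<cdot>\<^sub>v d) = t \<cdot>\<^sub>v e" for t
      using P d by (simp add: e_def mult_mat_vec[of _ n "n - 1"])
    \<comment> \<open>So the slice at the origin takes the value of the derivative of
      \<open>f\<close> in direction \<open>l\<close>, the base value of the difference
      quotient.\<close>
    have "transpose_mat (Proj R n l) *\<^sub>v 0\<^sub>v (n - 1) = 0\<^sub>v n"
      using P by (intro eq_vecI) auto
    then show ?thesis
      using projected_face_diff_right_derivative[OF R U d] l e
      unfolding has_dir_deriv_def slice_deriv_def te e_def[symmetric]
      by (simp add: f')
  qed
  then show ?thesis
    using projected_face_convex_bodies[OF R] U
    by (auto simp: quasidiff_pair_def reflect_convex_bodies reflect_reflect)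
qed

text \<open>The second conjunct ensures that the directed subdifferentials of the slices are
  genuine, since a definite description denotes some value even without a quasidifferential
  pair.\<close>

theorem corollary4p1:
  fixes R :: "nat \<Rightarrow> real vec \<Rightarrow> real mat"
    and n :: nat and f :: "real vec \<Rightarrow> real" and x :: "real vec" and U V :: "real vec set"
  assumes "rotation_family R"
    and "n \<ge> 1"
    and "x \<in> carrier_vec n"
    and "U \<in> convex_bodies n" and "V \<in> convex_bodies n"
    and "\<forall>l\<in>unit_sphere n. has_dir_deriv f x l (support_fun l U - support_fun l (reflect V))"
  shows "directed_subdiff R n f x =
      (if n = 1
       then Segment (dir_deriv f x (- unit_vec 1 0)) (dir_deriv f x (unit_vec 1 0))
       else Family (\<lambda>l\<in>unit_sphere n. directed_subdiff R (n - 1) (slice_deriv R n f x l) (0\<^sub>v (n - 1)))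
                   (\<lambda>l\<in>unit_sphere n. dir_deriv f x l))
    \<and> (n \<ge> 2 \<longrightarrow> (\<forall>l\<in>unit_sphere n. quasidifferentiable (n - 1) (slice_deriv R n f x l) (0\<^sub>v (n - 1))))"
proof -
  note R = assms(1)
  have q: "quasidiff_pair n f x U V"
    using assms by (simp add: quasidiff_pair_def)
  note slice = quasidiff_pair_slice_deriv[OF R _ _ assms(3) q]
  have f': "dir_deriv f x l = support_fun l U - support_fun l (reflect V)" if "l \<in> unit_sphere n" for l
    using assms(6) that by (simp add: dir_deriv_eq)
  have V: "reflect V \<in> convex_bodies n"
    using assms(5) by (rule reflect_convex_bodies)
  have eq: "directed_subdiff R n f x = dminus n (embed R n U) (embed R n (reflect V))"
    by (rule directed_subdiff_eq[OF R assms(2) q])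
  show ?thesis
  proof (cases "n = 1")
    case True
    then show ?thesis
      using eq f' unit_vec_1_unit_sphere V assms(4) by (simp add: embed_1 dminus_1 del: One_nat_def)
  next
    case False
    then obtain m where n: "n = Suc (Suc m)"
      using assms(2) by (metis One_nat_def not_one_le_zero old.nat.exhaust)
    have "directed_subdiff R (n - 1) (slice_deriv R n f x l) (0\<^sub>v (n - 1))
        = dminus (n - 1) (embed R (n - 1) (projected_face R n l U))
            (embed R (n - 1) (projected_face R n l (reflect V)))"
      if "l \<in> unit_sphere n" for l
      using directed_subdiff_eq[OF R _ slice[OF _ that]] by (simp add: n reflect_reflect)
    then have "directed_subdiff R n f x =
        Family (\<lambda>l\<in>unit_sphere n. directed_subdiff R (n - 1) (slice_deriv R n f x l) (0\<^sub>v (n - 1)))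
               (\<lambda>l\<in>unit_sphere n. dir_deriv f x l)"
      using f' unfolding eq by (auto simp: n fun_eq_iff)
    then show ?thesis
      using False slice by (auto simp: quasidifferentiable_def)
  qed
qed

end
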